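(* For every integer $\omega\ge1$, every $0<p<1$ and every integer $k\ge1$, $$\mathbb{P}_{\omega,p}(|C_0|\ge k)\le p\,\mathbb{P}(|\mathfrak{X}_\mu|\ge k),$$ where $\mu>0$ is defined by $e^{-\mu}=(1-p)^\omega$.
   Context: $\mathbb{Z}^2_{(\omega)}$ is the graph with vertex set $\mathbb{Z}^2$ in which two distinct vertices are joined if they agree in one coordinate and differ by at most $\omega$ in the other. Let $V$ be the random subset of $\mathbb{Z}^2$ obtained by selecting each point independently with probability $p$; $G_{\omega,p}$ is the subgraph of $\mathbb{Z}^2_{(\omega)}$ induced by $V$, and $\mathbb{P}_{\omega,p}$ is the corresponding probability measure. $C_0$ denotes the component of the origin in $G_{\omega,p}$, with $C_0=\emptyset$ if the origin is not a vertex of $G_{\omega,p}$; $|C_0|$ is its number of vertices. For $\mu>0$, $\Gamma_\mu$ denotes the geometric distribution $\mathbb{P}(\Gamma_\mu=k)=(1-e^{-\mu})^k e^{-\mu}$, $k=0,1,2,\ldots$, and $\Gamma_\mu^{(r)}$ is the distribution of the sum of $r$ independent copies of $\Gamma_\mu$. $\mathfrak{X}_\mu=(X_0,X_1,\ldots)$ is the branching process in which $X_0$ consists of a single particle whose number of children has distribution $\Gamma_\mu^{(4)}$, and each particle in $X_t$, $t\ge1$, has a number of children with distribution $\Gamma_\mu^{(2)}$, all particles having children independently of each other and of the history. $|\mathfrak{X}_\mu|$ denotes the total number of particles in all generations of $\mathfrak{X}_\mu$. *)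

theory Defs
  imports "HOL-Probability.Probability" "HOL-Library.Extended_Nat"
begin

definition ecard :: "'a set \<Rightarrow> enat" where
  "ecard A = (if finite A then enat (card A) else \<infinity>)"

definition lattice_adj :: "nat \<Rightarrow> int \<times> int \<Rightarrow> int \<times> int \<Rightarrow> bool" where
  "lattice_adj \<omega> u v \<longleftrightarrow> u \<noteq> v \<and>
     (fst u = fst v \<and> \<bar>snd u - snd v\<bar> \<le> int \<omega> \<or>
      snd u = snd v \<and> \<bar>fst u - fst v\<bar> \<le> int \<omega>)"

definition induced_adj :: "nat \<Rightarrow> (int \<times> int) set \<Rightarrow> int \<times> int \<Rightarrow> int \<times> int \<Rightarrow> bool" where
  "induced_adj \<omega> V u v \<longleftrightarrow> u \<in> V \<and> v \<in> V \<and> lattice_adj \<omega> u v"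

definition component :: "nat \<Rightarrow> (int \<times> int) set \<Rightarrow> int \<times> int \<Rightarrow> (int \<times> int) set" where
  "component \<omega> V v = (if v \<in> V then {w. (induced_adj \<omega> V)\<^sup>*\<^sup>* v w} else {})"

text \<open>A configuration \<open>s\<close> stands for the random set \<open>V = {v. s v}\<close>.\<close>

definition site_measure :: "real \<Rightarrow> (int \<times> int \<Rightarrow> bool) measure" where
  "site_measure p = (\<Pi>\<^sub>M v\<in>UNIV. measure_pmf (bernoulli_pmf p))"

text \<open>\<open>geometric_pmf q\<close> has mass \<open>(1 - q) ^ k * q\<close> at \<open>k\<close> (for \<open>0 < q \<le> 1\<close>); below,
  \<open>Gamma_sum_pmf r \<mu>\<close> is the law \<open>\<Gamma>\<^sub>\<mu>\<^sup>(\<^sup>r\<^sup>)\<close>.\<close>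

definition Gamma_pmf :: "real \<Rightarrow> nat pmf" where
  "Gamma_pmf \<mu> = geometric_pmf (exp (- \<mu>))"

definition Gamma_sum_pmf :: "nat \<Rightarrow> real \<Rightarrow> nat pmf" where
  "Gamma_sum_pmf r \<mu> = map_pmf sum_list (replicate_pmf r (Gamma_pmf \<mu>))"

text \<open>Particles of the branching process carry Ulam--Harris labels: the initial particle is
  \<open>[]\<close>, and the children of the particle \<open>u\<close> are \<open>i # u\<close> for \<open>i < \<xi> u\<close>, where \<open>\<xi> u\<close> is its
  number of children. The numbers \<open>\<xi> u\<close> are independent over all potential labels \<open>u\<close>.\<close>

fun generation :: "(nat list \<Rightarrow> nat) \<Rightarrow> nat \<Rightarrow> nat list set" where
  "generation \<xi> 0 = {[]}"
| "generation \<xi> (Suc t) = {i # u | i u. u \<in> generation \<xi> t \<and> i < \<xi> u}"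

definition total_progeny :: "(nat list \<Rightarrow> nat) \<Rightarrow> enat" where
  "total_progeny \<xi> = ecard (\<Union>t. generation \<xi> t)"

definition offspring_pmf :: "real \<Rightarrow> nat list \<Rightarrow> nat pmf" where
  "offspring_pmf \<mu> u = Gamma_sum_pmf (if u = [] then 4 else 2) \<mu>"

definition branching_measure :: "real \<Rightarrow> (nat list \<Rightarrow> nat) measure" where
  "branching_measure \<mu> = (\<Pi>\<^sub>M u\<in>UNIV. measure_pmf (offspring_pmf \<mu> u))"

end

theory Submission
  imports Defs
begin

text \<open>
  Both sides are compared with one random walk. Exploring \<open>C\<^sub>0\<close>, a task is a half-line starting at a
  vertex already found; scanning its first \<open>\<omega>\<close> sites reveals a new vertex with probability at most
  \<open>1 - (1 - p) ^ \<omega>\<close>, whatever was tested before. A hit replaces the task by three (straight ahead and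
  the two perpendicular directions; the way back is already known), a miss removes it. Since a
  \<open>\<Gamma>\<^sub>\<mu>\<close>-variable counts the hits of a chain of such tasks, each hit spawning two perpendicular ones,
  the branching process, in which the root has four tasks and every other particle two, performs
  exactly the walk in which tasks succeed with probability \<open>1 - e\<^sup>-\<^sup>\<mu>\<close>. Conditioning is avoided by bounding
  the measure of the intersection of the event with a finite cylinder (the information revealed).
\<close>

text \<open>The probability that the walk, started from \<open>m\<close> tasks, has at least \<open>j\<close> successes before no task
  is left; a task fails with probability \<open>q\<close>.\<close>

fun walk_prob :: "real \<Rightarrow> nat \<Rightarrow> nat \<Rightarrow> real" where
  "walk_prob q m 0 = 1"
| "walk_prob q 0 (Suc j) = 0"
| "walk_prob q (Suc m) (Suc j) = (1 - q) * walk_prob q (m + 3) j + q * walk_prob q m (Suc j)"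

section \<open>Bounds and monotonicity of the walk probabilities\<close>

lemma walk_prob_bounds:
  assumes "0 \<le> q" "q \<le> 1"
  shows "0 \<le> walk_prob q m j \<and> walk_prob q m j \<le> 1"
  using assms
proof (induction q m j rule: walk_prob.induct)
  case (3 q m j)
  then show ?case
    using convex_bound_le[of "walk_prob q (m + 3) j" 1 "walk_prob q m (Suc j)" "1 - q" q] by auto
qed auto

text \<open>Induction along the recursion, whose right-hand side increases in both recursive values.
  Together the two parts say that a hit (three tasks more, one success fewer to go) is at least as
  favourable as a miss; \<open>scan_bound\<close> relies on this.\<close>

lemma walk_prob_mono:
  assumes q: "0 \<le> q" "q \<le> 1"
  shows "m \<le> n \<Longrightarrow> walk_prob q m j \<le> walk_prob q n j"
    and "walk_prob q m (Suc j) \<le> walk_prob q m j"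
proof -
  have A: "walk_prob q m j \<le> walk_prob q (Suc m) j \<and> walk_prob q m (Suc j) \<le> walk_prob q m j" for m j
    using q
  proof (induction q m j rule: walk_prob.induct)
    case (1 q m)
    show ?case using walk_prob_bounds[of q m "Suc 0"] 1 by simp
  next
    case (2 q j)
    then show ?case
      using walk_prob_bounds[of q 3 j] by simp
  next
    case (3 q m j)
    note IH = 3(1)[OF 3(3,4)] 3(2)[OF 3(3,4)]
    have m4: "Suc (m + 3) = Suc m + 3" by simp
    have "walk_prob q (m + 3) j \<le> walk_prob q (Suc m + 3) j" using IH m4 by metis
    then have a: "walk_prob q (Suc m) (Suc j) \<le> walk_prob q (Suc (Suc m)) (Suc j)"
      using IH(2) 3(3,4) unfolding walk_prob.simps(3)
      by (intro add_mono mult_left_mono) (auto simp del: walk_prob.simps)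
    have "walk_prob q (Suc m) (Suc (Suc j)) \<le> walk_prob q (Suc m) (Suc j)"
      using IH 3(3,4) unfolding walk_prob.simps(3)
      by (intro add_mono mult_left_mono) (auto simp del: walk_prob.simps)
    with a show ?case by simp
  qed
  show "walk_prob q m (Suc j) \<le> walk_prob q m j" using A by blast
  show "m \<le> n \<Longrightarrow> walk_prob q m j \<le> walk_prob q n j"
    by (rule lift_Suc_mono_le[of "\<lambda>m. walk_prob q m j"]) (use A in auto)
qed

section \<open>Cylinders in products of discrete laws\<close>

definition cylinder :: "'a set \<Rightarrow> ('a \<Rightarrow> 'b) \<Rightarrow> ('a \<Rightarrow> 'b) set" where
  "cylinder K x = {s. \<forall>v\<in>K. s v = x v}"

lemma cylinder_insert:
  "w \<notin> K \<Longrightarrow> cylinder (insert w K) (x(w := b)) = cylinder K x \<inter> {s. s w = b}"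
  by (auto simp: cylinder_def)

lemma space_PiM_pmf: "space (\<Pi>\<^sub>M v\<in>UNIV. measure_pmf (P v)) = UNIV"
  by (auto simp: space_PiM)

lemma sets_PiM_pmf_component:
  "{s. Q (s w)} \<in> sets (\<Pi>\<^sub>M v\<in>UNIV. measure_pmf (P v))"
  using measurable_sets[OF measurable_component_singleton[of w UNIV "\<lambda>v. measure_pmf (P v)"], of "Collect Q"]
  by (simp add: space_PiM_pmf vimage_def)

lemma sets_cylinder:
  assumes "finite K"
  shows "cylinder K x \<in> sets (\<Pi>\<^sub>M v\<in>UNIV. measure_pmf (P v))"
proof -
  let ?M = "\<Pi>\<^sub>M v\<in>UNIV. measure_pmf (P v)"
  have "{s \<in> space ?M. \<forall>v\<in>K. s v = x v} \<in> sets ?M"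
    using assms by (intro sets.sets_Collect_finite_All)
      (auto simp: space_PiM_pmf intro: sets_PiM_pmf_component)
  then show ?thesis by (simp add: cylinder_def space_PiM_pmf)
qed

text \<open>Independence of the coordinates enters both comparisons only through this product
  formula.\<close>

lemma emeasure_cylinder:
  assumes "finite K"
  shows "emeasure (\<Pi>\<^sub>M v\<in>UNIV. measure_pmf (P v)) (cylinder K x) = ennreal (\<Prod>v\<in>K. pmf (P v) (x v))"
proof -
  interpret product_prob_space "\<lambda>v. measure_pmf (P v)" UNIV by unfold_locales
  have "emeasure (\<Pi>\<^sub>M v\<in>UNIV. measure_pmf (P v)) (cylinder K x)
      = (\<Prod>v\<in>K. emeasure (measure_pmf (P v)) {x v})"
    using emeasure_PiM_Collect[of K "\<lambda>v. {x v}"] assms by (simp add: cylinder_def space_PiM_pmf)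
  also have "\<dots> = ennreal (\<Prod>v\<in>K. pmf (P v) (x v))"
    by (simp add: emeasure_pmf_single prod_ennreal)
  finally show ?thesis .
qed

lemma measure_cylinder:
  assumes "finite K"
  shows "measure (\<Pi>\<^sub>M v\<in>UNIV. measure_pmf (P v)) (cylinder K x) = (\<Prod>v\<in>K. pmf (P v) (x v))"
  by (simp add: measure_def emeasure_cylinder[OF assms] prod_nonneg)

lemma measure_cylinder_insert:
  assumes "finite K" "w \<notin> K"
  shows "measure (\<Pi>\<^sub>M v\<in>UNIV. measure_pmf (P v)) (cylinder (insert w K) (x(w := b)))
    = pmf (P w) b * measure (\<Pi>\<^sub>M v\<in>UNIV. measure_pmf (P v)) (cylinder K x)"
  using assms by (simp add: measure_cylinder) (auto intro!: prod.cong)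

section \<open>Scans along half-lines of the lattice\<close>

definition axis_dirs :: "(int \<times> int) set" where
  "axis_dirs = {(1, 0), (-1, 0), (0, 1), (0, -1)}"

definition site_at :: "int \<times> int \<Rightarrow> int \<times> int \<Rightarrow> nat \<Rightarrow> int \<times> int" where
  "site_at v d i = (fst v + int i * fst d, snd v + int i * snd d)"

lemma site_at_site_at: "j \<le> i \<Longrightarrow> site_at (site_at v d j) d (i - j) = site_at v d i"
  by (simp add: site_at_def algebra_simps of_nat_diff)

lemma site_at_uminus:
  "i \<le> j \<Longrightarrow> site_at (site_at v d j) (- fst d, - snd d) i = site_at v d (j - i)"
  by (simp add: site_at_def algebra_simps of_nat_diff)

lemma site_at_0 [simp]: "site_at v d 0 = v"
  by (simp add: site_at_def)

lemma lattice_adj_site_at: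
  assumes "lattice_adj \<omega> u w"
  obtains d i where "d \<in> axis_dirs" "1 \<le> i" "i \<le> \<omega>" "w = site_at u d i"
proof -
  define a b where "a = fst w - fst u" and "b = snd w - snd u"
  have "a = 0 \<and> b \<noteq> 0 \<and> \<bar>b\<bar> \<le> int \<omega> \<or> b = 0 \<and> a \<noteq> 0 \<and> \<bar>a\<bar> \<le> int \<omega>"
    using assms unfolding lattice_adj_def a_def b_def by (auto simp: prod_eq_iff)
  then have signs: "a = 0 \<and> b > 0 \<and> b \<le> int \<omega> \<or> a = 0 \<and> b < 0 \<and> - b \<le> int \<omega> \<or>
      b = 0 \<and> a > 0 \<and> a \<le> int \<omega> \<or> b = 0 \<and> a < 0 \<and> - a \<le> int \<omega>"
    by arith
  have w: "w = (fst u + a, snd u + b)" by (simp add: a_def b_def)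
  from signs consider "a = 0" "b > 0" "b \<le> int \<omega>" | "a = 0" "b < 0" "- b \<le> int \<omega>"
    | "b = 0" "a > 0" "a \<le> int \<omega>" | "b = 0" "a < 0" "- a \<le> int \<omega>"
    by blast
  then show thesis
  proof cases
    case 1
    with w show ?thesis using that[of "(0, 1)" "nat b"]
      by (simp add: axis_dirs_def site_at_def)
  next
    case 2
    with w show ?thesis using that[of "(0, -1)" "nat (- b)"]
      by (simp add: axis_dirs_def site_at_def)
  next
    case 3
    with w show ?thesis using that[of "(1, 0)" "nat a"]
      by (simp add: axis_dirs_def site_at_def)
  next
    case 4
    with w show ?thesis using that[of "(-1, 0)" "nat (- a)"]
      by (simp add: axis_dirs_def site_at_def)
  qed
qed

text \<open>\<open>K\<close> is the set of tested sites and \<open>x\<close> records the outcomes. A scan from \<open>v\<close> in direction \<open>d\<close>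
  stops at the first site of \<open>V\<close> it meets: the sites behind that one are left to the scan that
  starts there.\<close>

definition found :: "(int \<times> int) set \<Rightarrow> (int \<times> int \<Rightarrow> bool) \<Rightarrow> (int \<times> int) set" where
  "found K x = {v \<in> K. x v}"

definition scanned ::
  "(int \<times> int) set \<Rightarrow> (int \<times> int \<Rightarrow> bool) \<Rightarrow> nat \<Rightarrow> int \<times> int \<Rightarrow> int \<times> int \<Rightarrow> bool" where
  "scanned K x t v d \<longleftrightarrow>
     (\<forall>i. 1 \<le> i \<and> i \<le> t \<longrightarrow> site_at v d i \<in> K \<or> (\<exists>j. 1 \<le> j \<and> j < i \<and> site_at v d j \<in> found K x))"

lemma found_insert:
  assumes "w \<notin> K"
  shows "found (insert w K) (x(w := b)) = (if b then insert w (found K x) else found K x)"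
  using assms by (auto simp: found_def)

lemma scanned_insert:
  assumes "w \<notin> K" "scanned K x t v d"
  shows "scanned (insert w K) (x(w := b)) t v d"
  using assms unfolding scanned_def by (auto simp: found_insert)

lemma scanned_Suc:
  assumes "scanned K x t v d"
    and "site_at v d (Suc t) \<in> K \<or> (\<exists>j. 1 \<le> j \<and> j \<le> t \<and> site_at v d j \<in> found K x)"
  shows "scanned K x (Suc t) v d"
  using assms unfolding scanned_def by (auto simp: le_Suc_eq less_Suc_eq_le)

text \<open>The hit itself blocks every site farther out, so the length \<open>n\<close> is
  arbitrary. This completes the task that produced the hit.\<close>

lemma scanned_hit:
  assumes "scanned K x t v d" "site_at v d (Suc t) \<in> found K x"
  shows "scanned K x n v d"
  unfolding scanned_def
proof (intro allI impI)
  fix i assume i: "1 \<le> i \<and> i \<le> n"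
  consider "i \<le> t" | "i = Suc t" | "Suc t < i" by linarith
  then show "site_at v d i \<in> K \<or> (\<exists>j. 1 \<le> j \<and> j < i \<and> site_at v d j \<in> found K x)"
  proof cases
    case 1
    with i assms(1) show ?thesis by (simp add: scanned_def)
  next
    case 2
    with assms(2) show ?thesis by (simp add: found_def)
  next
    case 3
    with assms(2) show ?thesis by (intro disjI2 exI[of _ "Suc t"]) simp
  qed
qed

text \<open>This is why a hit creates three tasks and not four: looking back, the sites before
  \<open>v\<close> were all tested by the scan from \<open>v\<close>, and \<open>v\<close> blocks
  whatever lies behind it. The last hypothesis excludes that one of the sites in between was skipped
  as blocked.\<close>

lemma scanned_back:
  assumes "scanned K x t v d" "v \<in> found K x" "\<nexists>j. 1 \<le> j \<and> j \<le> t \<and> site_at v d j \<in> found K x"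
  shows "scanned K x n (site_at v d (Suc t)) (- fst d, - snd d)"
  unfolding scanned_def
proof (intro allI impI)
  fix i assume i: "1 \<le> i \<and> i \<le> n"
  let ?w = "site_at v d (Suc t)" and ?d = "(- fst d, - snd d)"
  consider "i \<le> t" | "i = Suc t" | "Suc t < i" by linarith
  then show "site_at ?w ?d i \<in> K \<or> (\<exists>j. 1 \<le> j \<and> j < i \<and> site_at ?w ?d j \<in> found K x)"
  proof cases
    case 1
    with i have "1 \<le> Suc t - i" "Suc t - i \<le> t" by auto
    moreover from this have "\<not> (\<exists>j. 1 \<le> j \<and> j < Suc t - i \<and> site_at v d j \<in> found K x)"
      using assms(3) by (auto dest!: less_imp_le intro: order_trans)
    ultimately have "site_at v d (Suc t - i) \<in> K"
      using assms(1) unfolding scanned_def by blast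
    with 1 show ?thesis by (simp add: site_at_uminus)
  next
    case 2
    then show ?thesis using assms by (simp add: site_at_uminus found_def)
  next
    case 3
    then show ?thesis using assms(2) by (intro disjI2 exI[of _ "Suc t"]) (simp add: site_at_uminus)
  qed
qed

text \<open>Once every scan is complete, \<open>found K x\<close> is closed under adjacency in the
  graph of \<open>s\<close>, so no path from \<open>v0\<close> leaves it.\<close>

lemma component_subset_found:
  assumes all_scanned: "\<And>v d. v \<in> found K x \<Longrightarrow> d \<in> axis_dirs \<Longrightarrow> scanned K x \<omega> v d"
    and 0: "v0 \<in> found K x" and s: "s \<in> cylinder K x"
  shows "component \<omega> {v. s v} v0 \<subseteq> found K x"
proof
  \<comment> \<open>Strong induction on the distance: if the target was not tested, a found vertex
    lies strictly between, and the scan starting there has a shorter way to the target.\<close>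
  have hop: "site_at u d i \<in> found K x"
    if "u \<in> found K x" "d \<in> axis_dirs" "1 \<le> i" "i \<le> \<omega>" "s (site_at u d i)" for u d i
    using that
  proof (induction i arbitrary: u rule: less_induct)
    case (less i)
    consider "site_at u d i \<in> K" | j where "1 \<le> j" "j < i" "site_at u d j \<in> found K x"
      using all_scanned[OF less.prems(1,2)] less.prems(3,4) unfolding scanned_def by blast
    then show ?case
    proof cases
      case 1
      then show ?thesis using s less.prems by (simp add: cylinder_def found_def)
    next
      case 2
      then show ?thesis
        using less.IH[of "i - j" "site_at u d j"] less.prems by (simp add: site_at_site_at)
    qed
  qed
  fix w assume "w \<in> component \<omega> {v. s v} v0"
  then have "(induced_adj \<omega> {v. s v})\<^sup>*\<^sup>* v0 w"
    by (auto simp: component_def split: if_splits)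
  then show "w \<in> found K x"
  proof (induction rule: rtranclp_induct)
    case base
    show ?case by (rule 0)
  next
    case (step u w)
    then have "s w" "lattice_adj \<omega> u w" by (auto simp: induced_adj_def)
    obtain d i where "d \<in> axis_dirs" "1 \<le> i" "i \<le> \<omega>" "w = site_at u d i"
      using \<open>lattice_adj \<omega> u w\<close> by (rule lattice_adj_site_at)
    then show ?case using hop step.IH \<open>s w\<close> by blast
  qed
qed

text \<open>\<open>S\<close> contains the scans that are still pending.\<close>

definition exploration ::
  "nat \<Rightarrow> int \<times> int \<Rightarrow> (int \<times> int) set \<Rightarrow> (int \<times> int \<Rightarrow> bool)
    \<Rightarrow> ((int \<times> int) \<times> (int \<times> int)) set \<Rightarrow> bool" where
  "exploration \<omega> v0 K x S \<longleftrightarrow> finite K \<and> v0 \<in> found K x \<and> S \<subseteq> found K x \<times> axis_dirs \<and>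
     (\<forall>v\<in>found K x. \<forall>d\<in>axis_dirs. (v, d) \<notin> S \<longrightarrow> scanned K x \<omega> v d)"

section \<open>Steps of the exploration\<close>

definition large_component :: "nat \<Rightarrow> int \<times> int \<Rightarrow> nat \<Rightarrow> (int \<times> int \<Rightarrow> bool) set" where
  "large_component \<omega> v0 n = {s. ecard (component \<omega> {v. s v} v0) \<ge> enat n}"

lemma finite_axis_dirs: "finite axis_dirs" and card_axis_dirs: "card axis_dirs = 4"
  by (simp_all add: axis_dirs_def)

lemma exploration_finite: "exploration \<omega> v0 K x S \<Longrightarrow> finite (found K x) \<and> finite S"
  by (auto simp: exploration_def found_def finite_axis_dirs intro: finite_subset)

lemma exploration_miss:
  assumes "exploration \<omega> v0 K x S" "w \<notin> K"
  shows "exploration \<omega> v0 (insert w K) (x(w := False)) S"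
  using assms unfolding exploration_def by (auto simp: found_insert scanned_insert)

lemma card_axis_dirs_minus_opposite:
  assumes "d \<in> axis_dirs"
  shows "card (axis_dirs - {(- fst d, - snd d)}) = 3"
  using assms by (auto simp: axis_dirs_def)

text \<open>The old task \<open>(v, d)\<close> is complete by \<open>scanned_hit\<close>, and the
  direction from \<open>w\<close> back to \<open>v\<close> by \<open>scanned_back\<close>; the other
  three directions at \<open>w\<close> become pending.\<close>

lemma exploration_hit:
  fixes K v d t
  defines "w \<equiv> site_at v d (Suc t)"
  assumes E: "exploration \<omega> v0 K x (insert (v, d) S)" and vd: "(v, d) \<notin> S" "scanned K x t v d"
    and w: "w \<notin> K" "\<nexists>j. 1 \<le> j \<and> j \<le> t \<and> site_at v d j \<in> found K x"
  obtains S' where "exploration \<omega> v0 (insert w K) (x(w := True)) S'" "card S' = card S + 3"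
proof
  let ?d = "(- fst d, - snd d)" and ?K = "insert w K" and ?x = "x(w := True)"
  let ?N = "{w} \<times> (axis_dirs - {?d})"
  have v: "v \<in> found K x" "d \<in> axis_dirs" using E by (auto simp: exploration_def)
  have fin: "finite S" using exploration_finite[OF E] by simp
  have S: "S \<subseteq> found K x \<times> axis_dirs" using E by (auto simp: exploration_def)
  \<comment> \<open>Pending tasks start at found vertices, and \<open>w\<close> is untested, so the
    three new tasks are not in \<open>S\<close>.\<close>
  have "w \<notin> found K x" using w by (auto simp: found_def)
  then have "S \<inter> ?N = {}" using S by auto
  then show "card (S \<union> ?N) = card S + 3"
    using fin card_axis_dirs_minus_opposite[OF v(2)]
    by (simp add: card_Un_disjoint finite_axis_dirs card_cartesian_product)
  have f: "found ?K ?x = insert w (found K x)" using w by (simp add: found_insert)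
  have "scanned ?K ?x t v d" using w vd by (simp add: scanned_insert)
  then have 1: "scanned ?K ?x \<omega> v d"
    by (rule scanned_hit) (simp add: f flip: w_def)
  have "scanned K x \<omega> w ?d"
    unfolding w_def using scanned_back vd v w by blast
  then have 2: "scanned ?K ?x \<omega> w ?d" using w by (simp add: scanned_insert)
  show "exploration \<omega> v0 ?K ?x (S \<union> ?N)"
    unfolding exploration_def f
  proof (intro conjI ballI impI)
    show "finite ?K" "v0 \<in> insert w (found K x)" using E by (auto simp: exploration_def)
    show "S \<union> ?N \<subseteq> insert w (found K x) \<times> axis_dirs" using S by auto
    fix u e assume u: "u \<in> insert w (found K x)" "e \<in> axis_dirs" "(u, e) \<notin> S \<union> ?N"
    consider "u = w" "e = ?d" | "u = v" "e = d" | "u \<in> found K x" "(u, e) \<notin> insert (v, d) S"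
      using u by auto
    then show "scanned ?K ?x \<omega> u e"
    proof cases
      case 3
      then have "scanned K x \<omega> u e" using E u(2) by (auto simp: exploration_def)
      then show ?thesis using w by (simp add: scanned_insert)
    qed (use 1 2 in simp_all)
  qed
qed

lemma large_component_cylinder_empty:
  assumes "exploration \<omega> v0 K x {}" "n > card (found K x)"
  shows "cylinder K x \<inter> large_component \<omega> v0 n = {}"
proof -
  have fin: "finite (found K x)" using exploration_finite[OF assms(1)] by simp
  have "ecard (component \<omega> {v. s v} v0) < enat n" if "s \<in> cylinder K x" for s
  proof -
    have "component \<omega> {v. s v} v0 \<subseteq> found K x"
      using assms(1) that by (intro component_subset_found) (auto simp: exploration_def)
    then have "finite (component \<omega> {v. s v} v0)" "card (component \<omega> {v. s v} v0) \<le> card (found K x)"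
      using fin by (auto intro: finite_subset card_mono)
    then show ?thesis using assms(2) by (simp add: ecard_def)
  qed
  then show ?thesis by (auto simp: large_component_def not_le[symmetric])
qed

text \<open>A non-measurable \<open>X\<close> has \<open>measure\<close> 0 by convention. Hence the
  component event can be split according to one tested site without showing that it is
  measurable.\<close>

lemma (in finite_measure) measure_split_le:
  assumes "A \<in> sets M"
  shows "measure M X \<le> measure M (X \<inter> A) + measure M (X - A)"
proof (cases "X \<in> sets M")
  case True
  then show ?thesis using finite_measure_Union[of "X \<inter> A" "X - A"] assms
    by (simp add: Int_Diff_Un Int_Diff_disjoint)
qed (simp add: measure_notin_sets)

section \<open>Upper bound for the component by the walk\<close>

context
  fixes p :: real and \<omega> :: nat and v0 :: "int \<times> int"
  assumes p: "0 \<le> p" "p \<le> 1"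
begin

interpretation site: prob_space "site_measure p"
  unfolding site_measure_def by (intro prob_space_PiM prob_space_measure_pmf)

text \<open>Here \<open>j\<close> counts the vertices still missing: a hit enlarges
  \<open>found K x\<close> by one and lowers \<open>j\<close> by one, so the target size stays
  fixed.\<close>

definition exploration_bound where
  "exploration_bound m j \<longleftrightarrow> (\<forall>K x S. exploration \<omega> v0 K x S \<longrightarrow> card S \<le> m \<longrightarrow>
     measure (site_measure p) (cylinder K x \<inter> large_component \<omega> v0 (card (found K x) + j))
     \<le> measure (site_measure p) (cylinder K x) * walk_prob ((1 - p) ^ \<omega>) m j)"

text \<open>After \<open>t\<close> sites of the scan at most \<open>\<omega> - t\<close> fresh ones
  remain, all of which miss with probability at least \<open>(1 - p) ^ (\<omega> - t)\<close>. The
  hypotheses \<open>hit\<close> and \<open>miss\<close> bound what follows the end of the scan; the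
  induction runs downwards from \<open>t = \<omega>\<close>.\<close>

lemma scan_bound:
  assumes hit: "exploration_bound (m + 3) j" and miss: "exploration_bound m (Suc j)"
    and t: "t \<le> \<omega>"
  shows "exploration \<omega> v0 K x (insert (v, d) S) \<Longrightarrow> (v, d) \<notin> S \<Longrightarrow> card S \<le> m \<Longrightarrow>
    scanned K x t v d \<Longrightarrow>
    measure (site_measure p) (cylinder K x \<inter> large_component \<omega> v0 (card (found K x) + Suc j))
     \<le> measure (site_measure p) (cylinder K x) *
       ((1 - (1 - p) ^ (\<omega> - t)) * walk_prob ((1 - p) ^ \<omega>) (m + 3) j +
        (1 - p) ^ (\<omega> - t) * walk_prob ((1 - p) ^ \<omega>) m (Suc j))"
  using t
proof (induction t arbitrary: K x rule: inc_induct)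
  case base
  \<comment> \<open>At \<open>t = \<omega>\<close> the scan is complete, so \<open>(v, d)\<close> is
    no longer pending; the weight of a hit is \<open>1 - (1 - p) ^ 0 = 0\<close>.\<close>
  then have "exploration \<omega> v0 K x S" by (auto simp: exploration_def)
  with miss base show ?case by (simp add: exploration_bound_def)
next
  case (step t)
  note E = step.prems(1)
  let ?M = "site_measure p" and ?w = "site_at v d (Suc t)"
  define q where "q = (1 - p) ^ \<omega>"
  define r where "r = \<omega> - Suc t"
  have r: "\<omega> - t = Suc r" using step.hyps by (simp add: r_def)
  define W1 W0 where "W1 = walk_prob q (m + 3) j" and "W0 = walk_prob q m (Suc j)"
  have q: "0 \<le> q" "q \<le> 1" using p by (auto simp: q_def power_le_one)
  have "W0 \<le> walk_prob q m j" unfolding W0_def using q by (rule walk_prob_mono)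
  also have "\<dots> \<le> W1" unfolding W1_def using q by (rule walk_prob_mono) simp
  finally have W: "W0 \<le> W1" .
  define X where "X = cylinder K x \<inter> large_component \<omega> v0 (card (found K x) + Suc j)"
  have IH: "measure ?M (cylinder K' x' \<inter> large_component \<omega> v0 (card (found K' x') + Suc j))
      \<le> measure ?M (cylinder K' x') * ((1 - (1 - p) ^ r) * W1 + (1 - p) ^ r * W0)"
    if "exploration \<omega> v0 K' x' (insert (v, d) S)" "scanned K' x' (Suc t) v d" for K' x'
    using step.IH[OF that(1) step.prems(2,3) that(2)] unfolding r_def W1_def W0_def q_def .
  have "measure ?M X \<le> measure ?M (cylinder K x) * ((1 - (1 - p) ^ Suc r) * W1 + (1 - p) ^ Suc r * W0)"
  proof (cases "?w \<in> K \<or> (\<exists>j. 1 \<le> j \<and> j \<le> t \<and> site_at v d j \<in> found K x)")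
    case True
    then have "scanned K x (Suc t) v d" using step.prems(4) by (rule scanned_Suc[rotated])
    then have "measure ?M X \<le> measure ?M (cylinder K x) * ((1 - (1 - p) ^ r) * W1 + (1 - p) ^ r * W0)"
      using IH E unfolding X_def by blast
    \<comment> \<open>The next site reveals nothing new. Counting it as a fresh trial anyway only
      moves weight from \<open>W0\<close> to the larger \<open>W1\<close>.\<close>
    also have "\<dots> \<le> measure ?M (cylinder K x) * ((1 - (1 - p) ^ Suc r) * W1 + (1 - p) ^ Suc r * W0)"
    proof (rule mult_left_mono)
      have "(1 - p) ^ Suc r * (W1 - W0) \<le> (1 - p) ^ r * (W1 - W0)"
        using p W by (intro mult_right_mono power_decreasing) auto
      then show "(1 - (1 - p) ^ r) * W1 + (1 - p) ^ r * W0
          \<le> (1 - (1 - p) ^ Suc r) * W1 + (1 - p) ^ Suc r * W0"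
        by (simp add: algebra_simps)
    qed simp
    finally show ?thesis .
  next
    case False
    then have w: "?w \<notin> K" by blast
    have fin: "finite K" "finite (found K x)" "?w \<notin> found K x"
      using E w exploration_finite[OF E] by (auto simp: exploration_def found_def)
    let ?c = "measure ?M (cylinder K x)"
    have c: "measure ?M (cylinder (insert ?w K) (x(?w := b))) = (if b then p else 1 - p) * ?c" for b
      unfolding site_measure_def using p by (simp add: measure_cylinder_insert fin w)
    have eq: "X \<inter> {s. s ?w = b}
        = cylinder (insert ?w K) (x(?w := b)) \<inter> large_component \<omega> v0 (card (found K x) + Suc j)" for b
      unfolding X_def cylinder_insert[OF w] by blast
    have 1: "measure ?M (X \<inter> {s. s ?w = True}) \<le> p * ?c * W1"
    proof -
      obtain S' where S': "exploration \<omega> v0 (insert ?w K) (x(?w := True)) S'" "card S' = card S + 3"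
        using exploration_hit[OF E step.prems(2,4) w] False by blast
      have "card (found (insert ?w K) (x(?w := True))) = Suc (card (found K x))"
        using w fin by (simp add: found_insert)
      then show ?thesis
        using hit S' step.prems(3) c[of True] unfolding eq exploration_bound_def W1_def q_def by fastforce
    qed
    have 2: "measure ?M (X \<inter> {s. s ?w = False}) \<le> (1 - p) * ?c * ((1 - (1 - p) ^ r) * W1 + (1 - p) ^ r * W0)"
    proof -
      have "scanned (insert ?w K) (x(?w := False)) (Suc t) v d"
        using step.prems(4) w by (intro scanned_Suc) (auto simp: scanned_insert)
      then show ?thesis
        using IH[OF exploration_miss[OF E w]] c[of False] w unfolding eq by (simp add: found_insert)
    qed
    have "{s. s ?w = True} \<in> sets ?M"
      unfolding site_measure_def by (rule sets_PiM_pmf_component)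
    from site.measure_split_le[OF this, of X]
    have "measure ?M X \<le> measure ?M (X \<inter> {s. s ?w = True}) + measure ?M (X \<inter> {s. s ?w = False})"
      by (simp add: Diff_eq Collect_neg_eq)
    also have "\<dots> \<le> p * ?c * W1 + (1 - p) * ?c * ((1 - (1 - p) ^ r) * W1 + (1 - p) ^ r * W0)"
      using 1 2 by (rule add_mono)
    also have "\<dots> = ?c * ((1 - (1 - p) ^ Suc r) * W1 + (1 - p) ^ Suc r * W0)"
      by (simp add: algebra_simps)
    finally show ?thesis .
  qed
  then show ?case unfolding X_def r W1_def W0_def q_def .
qed

lemma exploration_bound: "exploration_bound m j"
proof (induction "(1 - p) ^ \<omega>" m j rule: walk_prob.induct)
  case (1 m)
  have "measure (site_measure p) (cylinder K x \<inter> X) \<le> measure (site_measure p) (cylinder K x)"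
    if "finite K" for K x X
    using that by (intro site.finite_measure_mono) (simp_all add: site_measure_def sets_cylinder)
  then show ?case
    unfolding exploration_bound_def by (auto simp: exploration_def)
next
  case (2 j)
  have "S = {}" if "exploration \<omega> v0 K x S" "card S \<le> 0" for K x S
    using that exploration_finite by fastforce
  then show ?case
    unfolding exploration_bound_def by (fastforce simp: large_component_cylinder_empty)
next
  case (3 m j)
  show ?case unfolding exploration_bound_def
  proof (intro allI impI)
    fix K x S assume E: "exploration \<omega> v0 K x S" and S: "card S \<le> Suc m"
    let ?M = "site_measure p" 
    show "measure ?M (cylinder K x \<inter> large_component \<omega> v0 (card (found K x) + Suc j))
      \<le> measure ?M (cylinder K x) * walk_prob ((1 - p) ^ \<omega>) (Suc m) (Suc j)"
    proof (cases "S = {}")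
      case True
      have "0 \<le> walk_prob ((1 - p) ^ \<omega>) (Suc m) (Suc j)"
        using walk_prob_bounds p by (simp add: power_le_one del: walk_prob.simps)
      then show ?thesis using E True by (simp add: large_component_cylinder_empty del: walk_prob.simps)
    next
      case False
      then obtain v d where vd: "(v, d) \<in> S" by auto
      define S' where "S' = S - {(v, d)}"
      have S': "S = insert (v, d) S'" "(v, d) \<notin> S'" using vd by (auto simp: S'_def)
      then have "card S' \<le> m" using S exploration_finite[OF E] by simp
      \<comment> \<open>A task starts with \<open>t = 0\<close>, where \<open>scanned\<close> is
        vacuous; the miss weight is then \<open>(1 - p) ^ \<omega>\<close>, the failure probability
        of the walk.\<close>
      then show ?thesis
        using scan_bound[OF 3(1) 3(2), of 0 K x v d S'] E S' by (simp add: scanned_def)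
    qed
  qed
qed

text \<open>The component is empty unless \<open>v0\<close> is selected, which gives the factor
  \<open>p\<close>. After that one vertex is found, \<open>j\<close> are missing, and all four
  directions at \<open>v0\<close> are pending.\<close>

theorem large_component_bound:
  "measure (site_measure p) (large_component \<omega> v0 (Suc j)) \<le> p * walk_prob ((1 - p) ^ \<omega>) 4 j"
proof -
  let ?M = "site_measure p" and ?x = "\<lambda>_. True"
  have f: "found {v0} ?x = {v0}" by (auto simp: found_def)
  have "exploration \<omega> v0 {v0} ?x ({v0} \<times> axis_dirs)"
    by (auto simp: exploration_def f)
  then have "measure ?M (cylinder {v0} ?x \<inter> large_component \<omega> v0 (Suc j))
      \<le> measure ?M (cylinder {v0} ?x) * walk_prob ((1 - p) ^ \<omega>) 4 j"
    using exploration_bound[of 4 j] card_axis_dirs f unfolding exploration_bound_def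
    by (fastforce simp: card_cartesian_product)
  moreover have "measure ?M (cylinder {v0} ?x) = p"
    unfolding site_measure_def using p by (simp add: measure_cylinder)
  moreover have "large_component \<omega> v0 (Suc j) \<subseteq> cylinder {v0} ?x"
    by (auto simp: large_component_def cylinder_def component_def ecard_def zero_enat_def[symmetric])
  ultimately show ?thesis by (simp add: Int_absorb1)
qed

end

section \<open>Geometric variables as chains of tasks\<close>

lemma nn_integral_geometric_pmf:
  assumes "0 < q" "q \<le> 1"
  shows "(\<integral>\<^sup>+c. g c \<partial>geometric_pmf q)
    = ennreal q * g 0 + ennreal (1 - q) * (\<integral>\<^sup>+c. g (Suc c) \<partial>geometric_pmf q)"
proof -
  have "(\<integral>\<^sup>+c. g c \<partial>geometric_pmf q) = (\<integral>\<^sup>+b. (\<integral>\<^sup>+c. g c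
      \<partial>(if b then return_pmf 0 else map_pmf Suc (geometric_pmf q))) \<partial>bernoulli_pmf q)"
    using assms by (subst geometric_bind_pmf_unfold) auto
  then show ?thesis using assms by (simp add: mult.commute)
qed

text \<open>One task is followed straight ahead until its first miss: \<open>c\<close> hits leave
  \<open>2 * c\<close> perpendicular tasks besides the \<open>m\<close> waiting ones. For
  \<open>c \<ge> j\<close> the truncated difference \<open>j - c\<close> is 0, where
  \<open>walk_prob\<close> is 1, as it should be.\<close>

lemma walk_prob_geometric:
  assumes "0 < q" "q \<le> 1"
  shows "(\<integral>\<^sup>+c. ennreal (walk_prob q (m + 2 * c) (j - c)) \<partial>geometric_pmf q)
    = ennreal (walk_prob q (Suc m) j)"
proof (induction j arbitrary: m)
  case 0
  then show ?case by simp
next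
  case (Suc j)
  have "(\<integral>\<^sup>+c. ennreal (walk_prob q (m + 2 * Suc c) (Suc j - Suc c)) \<partial>geometric_pmf q)
      = ennreal (walk_prob q (m + 3) j)"
    using Suc[of "m + 2"] by (simp add: algebra_simps eval_nat_numeral)
  then show ?case
    using assms walk_prob_bounds[of q]
    by (subst nn_integral_geometric_pmf) (simp_all add: ennreal_mult ennreal_plus add.commute)
qed

text \<open>The chains of \<open>r\<close> tasks are run one after the other, each being an
  independent geometric variable; the perpendicular tasks they create wait.\<close>

lemma walk_prob_Gamma_sum:
  assumes "0 < \<mu>"
  shows "(\<integral>\<^sup>+c. ennreal (walk_prob (exp (- \<mu>)) (m + 2 * c) (j - c)) \<partial>Gamma_sum_pmf r \<mu>)
    = ennreal (walk_prob (exp (- \<mu>)) (m + r) j)"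
proof (induction r arbitrary: m j)
  case 0
  show ?case by (simp add: Gamma_sum_pmf_def)
next
  case (Suc r)
  let ?W = "\<lambda>m j. ennreal (walk_prob (exp (- \<mu>)) m j)"
  have "(\<integral>\<^sup>+c. ?W (m + 2 * c) (j - c) \<partial>Gamma_sum_pmf (Suc r) \<mu>)
      = (\<integral>\<^sup>+a. \<integral>\<^sup>+c. ?W (m + 2 * a + 2 * c) (j - a - c) \<partial>Gamma_sum_pmf r \<mu> \<partial>Gamma_pmf \<mu>)"
    by (simp add: Gamma_sum_pmf_def algebra_simps)
  also have "\<dots> = (\<integral>\<^sup>+a. ?W (m + r + 2 * a) (j - a) \<partial>Gamma_pmf \<mu>)"
    unfolding Suc by (simp add: algebra_simps)
  also have "\<dots> = ?W (m + Suc r) j"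
    unfolding Gamma_pmf_def using assms by (subst walk_prob_geometric) auto
  finally show ?case .
qed

section \<open>Labels of the progeny, measurability, and finite revealed trees\<close>

definition progeny :: "(nat list \<Rightarrow> nat) \<Rightarrow> nat list set" where
  "progeny \<xi> = (\<Union>t. generation \<xi> t)"

lemma Nil_in_progeny: "[] \<in> progeny \<xi>"
  unfolding progeny_def by (rule UN_I[of 0]) auto

text \<open>Replaces the generation index by recursion on the label, whose tail is the
  parent.\<close>

lemma Cons_in_progeny_iff: "i # u \<in> progeny \<xi> \<longleftrightarrow> u \<in> progeny \<xi> \<and> i < \<xi> u"
proof
  assume "i # u \<in> progeny \<xi>"
  then obtain t where t: "i # u \<in> generation \<xi> t" by (auto simp: progeny_def)
  then show "u \<in> progeny \<xi> \<and> i < \<xi> u"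
    by (cases t) (auto simp: progeny_def)
next
  assume "u \<in> progeny \<xi> \<and> i < \<xi> u"
  then obtain t where "u \<in> generation \<xi> t" "i < \<xi> u" by (auto simp: progeny_def)
  then have "i # u \<in> generation \<xi> (Suc t)" by simp
  then show "i # u \<in> progeny \<xi>" unfolding progeny_def by blast
qed

definition large_progeny :: "nat \<Rightarrow> (nat list \<Rightarrow> nat) set" where
  "large_progeny n = {\<xi>. total_progeny \<xi> \<ge> enat n}"

lemma ecard_ge_iff: "enat n \<le> ecard A \<longleftrightarrow> (\<exists>F. finite F \<and> card F = n \<and> F \<subseteq> A)"
proof (cases "finite A")
  case True
  then show ?thesis
    by (auto simp: ecard_def intro: card_mono elim!: obtain_subset_with_card_n)
next
  case False
  then show ?thesis
    using infinite_arbitrarily_large[of A n] by (auto simp: ecard_def)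
qed

lemma large_progeny_iff:
  "\<xi> \<in> large_progeny n \<longleftrightarrow> (\<exists>F. finite F \<and> card F = n \<and> F \<subseteq> progeny \<xi>)"
  by (simp add: large_progeny_def total_progeny_def progeny_def ecard_ge_iff)

lemma large_progeny_antimono: "m \<le> n \<Longrightarrow> large_progeny n \<subseteq> large_progeny m"
  unfolding large_progeny_def by (auto intro: order_trans[of "enat m" "enat n"])

lemma sets_in_progeny: "{\<xi>. u \<in> progeny \<xi>} \<in> sets (branching_measure \<mu>)"
proof (induction u)
  case Nil
  have "space (branching_measure \<mu>) = UNIV"
    by (simp add: branching_measure_def space_PiM_pmf)
  then show ?case using sets.top[of "branching_measure \<mu>"] by (simp add: Nil_in_progeny)
next
  case (Cons i u)
  have "{\<xi>. i < \<xi> u} \<in> sets (branching_measure \<mu>)"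
    unfolding branching_measure_def by (rule sets_PiM_pmf_component)
  with Cons have "{\<xi>. u \<in> progeny \<xi>} \<inter> {\<xi>. i < \<xi> u} \<in> sets (branching_measure \<mu>)" by (rule sets.Int)
  then show ?case by (simp add: Cons_in_progeny_iff Collect_conj_eq)
qed

text \<open>There are only countably many finite sets \<open>F\<close> of labels, and each event
  \<open>F \<subseteq> progeny \<xi>\<close> is a finite intersection. Measurability matters on this
  side because the lower bound sums over the disjoint values of an offspring number.\<close>

lemma sets_large_progeny: "large_progeny n \<in> sets (branching_measure \<mu>)"
proof -
  have "{\<xi> \<in> space (branching_measure \<mu>). \<forall>u\<in>F. u \<in> progeny \<xi>} \<in> sets (branching_measure \<mu>)"
    if "finite F" for F
    using that sets_in_progeny by (intro sets.sets_Collect_finite_All)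
      (auto simp: branching_measure_def space_PiM_pmf)
  then have "{\<xi>. F \<subseteq> progeny \<xi>} \<in> sets (branching_measure \<mu>)" if "finite F" for F
    using that by (simp add: branching_measure_def space_PiM_pmf subset_eq)
  then have "(\<Union>F\<in>{F. finite F \<and> card F = n}. {\<xi>. F \<subseteq> progeny \<xi>}) \<in> sets (branching_measure \<mu>)"
    by (intro sets.countable_UN'')
      (auto intro: countable_subset[OF _ countable_Collect_finite])
  also have "(\<Union>F\<in>{F. finite F \<and> card F = n}. {\<xi>. F \<subseteq> progeny \<xi>}) = large_progeny n"
    by (auto simp: large_progeny_iff)
  finally show ?thesis .
qed

text \<open>\<open>U\<close> consists of the particles whose number of children is revealed (it is \<open>x u\<close>), \<open>L\<close> of their
  children that are not in \<open>U\<close>, and of the root at the start.\<close>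

definition tree_state :: "nat list set \<Rightarrow> (nat list \<Rightarrow> nat) \<Rightarrow> nat list set \<Rightarrow> bool" where
  "tree_state U x L \<longleftrightarrow> finite U \<and> finite L \<and> U \<inter> L = {} \<and>
     (\<forall>i u. i # u \<in> U \<union> L \<longrightarrow> u \<in> U \<and> i < x u)"

lemma tree_state_progeny:
  assumes "tree_state U x L" "\<xi> \<in> cylinder U x"
  shows "u \<in> U \<union> L \<Longrightarrow> u \<in> progeny \<xi>"
proof (induction u)
  case Nil
  show ?case by (rule Nil_in_progeny)
next
  case (Cons i u)
  then have "u \<in> U" "i < x u" using assms(1) by (auto simp: tree_state_def)
  then show ?case using Cons.IH assms(2) by (simp add: Cons_in_progeny_iff cylinder_def)
qed

lemma tree_state_cylinder_subset:
  assumes "tree_state U x L"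
  shows "cylinder U x \<subseteq> large_progeny (card U + card L)"
proof
  fix \<xi> assume "\<xi> \<in> cylinder U x"
  then have "U \<union> L \<subseteq> progeny \<xi>" using assms tree_state_progeny by blast
  moreover have "finite (U \<union> L)" "card (U \<union> L) = card U + card L"
    using assms by (auto simp: tree_state_def card_Un_disjoint)
  ultimately show "\<xi> \<in> large_progeny (card U + card L)" unfolding large_progeny_iff by blast
qed

text \<open>The number of tasks of the walk that an unrevealed particle stands for;
  \<open>sum arity L\<close> is thus the number of pending tasks.\<close>

definition arity :: "nat list \<Rightarrow> nat" where
  "arity u = (if u = [] then 4 else 2)"

lemma offspring_pmf_arity: "offspring_pmf \<mu> u = Gamma_sum_pmf (arity u) \<mu>"
  by (simp add: offspring_pmf_def arity_def)

lemma tree_state_reveal: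
  assumes T: "tree_state U x L" and u: "u \<in> L"
  defines "L' c \<equiv> (L - {u}) \<union> (\<lambda>i. i # u) ` {..<c}"
  shows "tree_state (insert u U) (x(u := c)) (L' c)"
    and "card (L' c) + 1 = card L + c"
    and "sum arity (L' c) = sum arity (L - {u}) + 2 * c"
proof -
  \<comment> \<open>A child of \<open>u\<close> lying in \<open>U \<union> L\<close> would force
    \<open>u \<in> U\<close>.\<close>
  have notU: "u \<notin> U" and new: "i # u \<notin> U \<union> L" for i using T u by (auto simp: tree_state_def)
  have fin: "finite L" using T by (auto simp: tree_state_def)
  have inj: "inj_on (\<lambda>i. i # u) {..<c}" by (auto simp: inj_on_def)
  have disj: "(L - {u}) \<inter> (\<lambda>i. i # u) ` {..<c} = {}" using new by auto
  show "tree_state (insert u U) (x(u := c)) (L' c)"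
    using T notU new u unfolding tree_state_def L'_def by auto
  show "card (L' c) + 1 = card L + c"
    using fin u disj inj card_gt_0_iff[of L] unfolding L'_def
    by (subst card_Un_disjoint) (auto simp: card_image card_Diff_singleton)
  show "sum arity (L' c) = sum arity (L - {u}) + 2 * c"
    using fin disj inj unfolding L'_def
    by (subst sum.union_disjoint) (auto simp: sum.reindex arity_def)
qed

lemma emeasure_cylinder_split:
  assumes "finite U" "u \<notin> U" and X: "X \<in> sets (\<Pi>\<^sub>M v\<in>UNIV. measure_pmf (P v))"
  shows "emeasure (\<Pi>\<^sub>M v\<in>UNIV. measure_pmf (P v)) (cylinder U x \<inter> X)
    = (\<Sum>c. emeasure (\<Pi>\<^sub>M v\<in>UNIV. measure_pmf (P v)) (cylinder (insert u U) (x(u := c :: nat)) \<inter> X))"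
proof -
  have "cylinder U x \<inter> X = (\<Union>c. cylinder (insert u U) (x(u := c)) \<inter> X)"
    unfolding cylinder_insert[OF assms(2)] by auto
  moreover have "disjoint_family (\<lambda>c. cylinder (insert u U) (x(u := c)) \<inter> X)"
    unfolding cylinder_insert[OF assms(2)] by (auto simp: disjoint_family_on_def)
  moreover have "range (\<lambda>c. cylinder (insert u U) (x(u := c)) \<inter> X) \<subseteq> sets (\<Pi>\<^sub>M v\<in>UNIV. measure_pmf (P v))"
    using assms by (auto intro!: sets.Int sets_cylinder)
  ultimately show ?thesis by (simp add: suminf_emeasure)
qed

section \<open>Lower bound for the progeny by the walk\<close>

context
  fixes \<mu> :: real
  assumes \<mu>: "\<mu> > 0"
begin

text \<open>All of \<open>U \<union> L\<close> is known to belong to the progeny, and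
  \<open>j\<close> more particles are wanted. Revealing some \<open>u \<in> L\<close> lowers
  \<open>j\<close> if it has children and shrinks \<open>L\<close> otherwise, hence the
  lexicographic induction.\<close>

lemma tree_state_bound:
  assumes "tree_state U x L"
  shows "emeasure (branching_measure \<mu>) (cylinder U x) * ennreal (walk_prob (exp (- \<mu>)) (sum arity L) j)
    \<le> emeasure (branching_measure \<mu>) (cylinder U x \<inter> large_progeny (card U + card L + j))"
  using assms
proof (induction "(j, card L)" arbitrary: j U x L rule: wf_induct_rule[OF wf_lex_prod[OF wf_less_than wf_less_than]])
  case 1
  note T = "1.prems"
  let ?M = "branching_measure \<mu>" and ?W = "\<lambda>m j. ennreal (walk_prob (exp (- \<mu>)) m j)"
  let ?big = "large_progeny (card U + card L + j)"
  consider "j = 0" | "j > 0" "L = {}" | u where "j > 0" "u \<in> L" by blast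
  then show ?case
  proof cases
    case 1
    then show ?thesis using tree_state_cylinder_subset[OF T] by (simp add: Int_absorb2)
  next
    case 2
    then show ?thesis by (cases j) auto
  next
    case 3
    define L' where "L' c = (L - {u}) \<union> (\<lambda>i. i # u) ` {..<c}" for c
    note L' = tree_state_reveal[OF T 3(2), folded L'_def]
    have U: "finite U" "u \<notin> U" using T 3 by (auto simp: tree_state_def)
    have sL: "sum arity L = sum arity (L - {u}) + arity u"
      using T 3 by (simp add: tree_state_def sum.remove)
    have cyl: "emeasure ?M (cylinder (insert u U) (x(u := c)))
        = emeasure ?M (cylinder U x) * ennreal (pmf (offspring_pmf \<mu> u) c)" for c
    proof -
      have "(\<Prod>v\<in>U. pmf (offspring_pmf \<mu> v) ((x(u := c)) v)) = (\<Prod>v\<in>U. pmf (offspring_pmf \<mu> v) (x v))"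
        using U by (intro prod.cong) auto
      then show ?thesis using U
        by (simp add: branching_measure_def emeasure_cylinder ennreal_mult prod_nonneg mult.commute)
    qed
    \<comment> \<open>The walk is run through the \<open>arity u\<close> chains belonging to
      \<open>u\<close>; their total number of hits has the law of the number of children of
      \<open>u\<close>.\<close>
    have "emeasure ?M (cylinder U x) * ?W (sum arity L) j
        = emeasure ?M (cylinder U x) *
          (\<integral>\<^sup>+c. ?W (sum arity (L - {u}) + 2 * c) (j - c) \<partial>offspring_pmf \<mu> u)"
      by (simp only: sL offspring_pmf_arity
        walk_prob_Gamma_sum[OF \<mu>, where m = "sum arity (L - {u})" and r = "arity u" and j = j])
    also have "\<dots> = emeasure ?M (cylinder U x) *
        (\<Sum>c. ennreal (pmf (offspring_pmf \<mu> u) c) * ?W (sum arity (L - {u}) + 2 * c) (j - c))"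
      by (simp add: nn_integral_measure_pmf nn_integral_count_space_nat)
    also have "\<dots> = (\<Sum>c. emeasure ?M (cylinder (insert u U) (x(u := c))) * ?W (sum arity (L' c)) (j - c))"
      unfolding ennreal_suminf_cmult[symmetric] cyl L'(3) mult.assoc ..
    also have "\<dots> \<le> (\<Sum>c. emeasure ?M (cylinder (insert u U) (x(u := c)) \<inter> ?big))"
    proof (intro suminf_le summableI)
      fix c
      have "((j - c, card (L' c)), (j, card L)) \<in> less_than <*lex*> less_than"
        using 3(1) L'(2)[of c] by (cases "c = 0") auto
      then have "emeasure ?M (cylinder (insert u U) (x(u := c))) * ?W (sum arity (L' c)) (j - c)
          \<le> emeasure ?M (cylinder (insert u U) (x(u := c)) \<inter>
              large_progeny (card (insert u U) + card (L' c) + (j - c)))"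
        using L'(1) by (rule "1.hyps")
      \<comment> \<open>The target on the left is \<open>card U + card L + c + (j - c)\<close>: it
        equals the old one for \<open>c \<le> j\<close> and exceeds it for
        \<open>c > j\<close>.\<close>
      also have "\<dots> \<le> emeasure ?M (cylinder (insert u U) (x(u := c)) \<inter> ?big)"
        using U L'(2)[of c] sets_large_progeny
        by (intro emeasure_mono Int_mono large_progeny_antimono sets.Int order_refl)
          (auto simp: branching_measure_def intro!: sets_cylinder)
      finally show "emeasure ?M (cylinder (insert u U) (x(u := c))) * ?W (sum arity (L' c)) (j - c)
          \<le> emeasure ?M (cylinder (insert u U) (x(u := c)) \<inter> ?big)" .
    qed
    also have "\<dots> = emeasure ?M (cylinder U x \<inter> ?big)"
      using sets_large_progeny[of _ \<mu>] U unfolding branching_measure_def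
      by (intro emeasure_cylinder_split[symmetric]) auto
    finally show ?thesis .
  qed
qed

theorem large_progeny_bound:
  "walk_prob (exp (- \<mu>)) 4 j \<le> measure (branching_measure \<mu>) (large_progeny (Suc j))"
proof -
  interpret prob_space "branching_measure \<mu>"
    unfolding branching_measure_def by (intro prob_space_PiM prob_space_measure_pmf)
  have "cylinder {} x = space (branching_measure \<mu>)" for x
    by (auto simp: cylinder_def branching_measure_def space_PiM_pmf)
  moreover have "tree_state {} x {[]}" for x
    by (simp add: tree_state_def)
  ultimately have "ennreal (walk_prob (exp (- \<mu>)) 4 j)
      \<le> emeasure (branching_measure \<mu>) (large_progeny (Suc j))"
    \<comment> \<open>Nothing is revealed yet: the empty cylinder condition has measure 1, and the
      root alone gives four tasks and the target \<open>0 + 1 + j\<close>.\<close>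
    using tree_state_bound[of "{}" undefined "{[]}" j] sets.sets_into_space[OF sets_large_progeny]
    by (simp add: arity_def emeasure_space_1 Int_absorb1)
  then show ?thesis by (simp add: emeasure_eq_measure)
qed

end

theorem mainTheorem3:
  fixes \<omega> k :: nat and p \<mu> :: real
  assumes "\<omega> \<ge> 1" and "0 < p" and "p < 1" and "k \<ge> 1"
    and "\<mu> > 0" and "exp (- \<mu>) = (1 - p) ^ \<omega>"
  shows "\<P>(s in site_measure p. ecard (component \<omega> {v. s v} (0, 0)) \<ge> enat k)
    \<le> p * \<P>(\<xi> in branching_measure \<mu>. total_progeny \<xi> \<ge> enat k)"
proof -
  \<comment> \<open>The origin and the root each count for one, so on both sides the walk needs
    \<open>k - 1\<close> successes.\<close>
  obtain j where k: "k = Suc j" using assms(4) by (cases k) auto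
  have "measure (site_measure p) (large_component \<omega> (0, 0) k) \<le> p * walk_prob (exp (- \<mu>)) 4 j"
    unfolding k assms(6) using assms(2,3) by (intro large_component_bound) auto
  also have "\<dots> \<le> p * measure (branching_measure \<mu>) (large_progeny k)"
    unfolding k using assms(2,5) by (intro mult_left_mono large_progeny_bound) auto
  finally show ?thesis
    by (simp add: large_component_def large_progeny_def site_measure_def branching_measure_def space_PiM_pmf)
qed

end
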